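(* Let $n \geq 1$ and let $A$ be an $n \times n$ matrix with real entries. Then $A$ is invertible if and only if $A$ is row-equivalent to the $n \times n$ identity matrix $I$.
   Context: All matrices are $n \times n$ with real entries, and $I$ denotes the $n \times n$ identity matrix. A matrix $A$ is invertible if there is an $n \times n$ matrix $X$ with $AX = XA = I$. Two matrices are row-equivalent if one can be obtained from the other by a finite sequence of elementary row operations (interchanging two rows, multiplying a row by a nonzero scalar, adding a scalar multiple of one row to a different row). *)

theory Defs
  imports "Jordan_Normal_Form.Gauss_Jordan_Elimination"
begin

(* Row indices start at 0, and the conditions k < dim_row A and l < dim_row A are needed
   because the library operations swaprows, multrow, addrow accept arbitrary indices.
   addrow c k l A adds c times row l to row k. *)
inductive elem_row_op :: "'a :: field mat \<Rightarrow> 'a mat \<Rightarrow> bool" where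
  swap: "k < dim_row A \<Longrightarrow> l < dim_row A \<Longrightarrow> k \<noteq> l \<Longrightarrow> elem_row_op A (swaprows k l A)"
| scale: "k < dim_row A \<Longrightarrow> c \<noteq> 0 \<Longrightarrow> elem_row_op A (multrow k c A)"
| add: "k < dim_row A \<Longrightarrow> l < dim_row A \<Longrightarrow> k \<noteq> l \<Longrightarrow> elem_row_op A (addrow c k l A)"

(* "One can be obtained from the other" does not say which from which; no symmetry of
   elem_row_op is presupposed, hence the disjunction. *)
definition row_equivalent :: "'a :: field mat \<Rightarrow> 'a mat \<Rightarrow> bool" where
  "row_equivalent A B \<longleftrightarrow> elem_row_op\<^sup>*\<^sup>* A B \<or> elem_row_op\<^sup>*\<^sup>* B A"

end

theory Submission
  imports Defs
begin

text \<open>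
  Over any field, the matrices reachable from an \<open>n\<close>-row matrix \<open>A\<close> by row operations are of the form
  \<open>P * A\<close> with \<open>P\<close> a unit of the ring of \<open>n \<times> n\<close> matrices, because each operation is left
  multiplication by an elementary matrix, and these are units (lemma \<open>row_ops_left_mult_Unit\<close>).
  If \<open>A\<close> leads to the identity, then \<open>P * A = 1\<close> and \<open>A\<close> is the inverse of \<open>P\<close>; if the identity
  leads to \<open>A\<close>, then \<open>A = P\<close>. Either way \<open>A\<close> is invertible, so the unspecified direction in
  row equivalence is harmless.

  Conversely, Gauss-Jordan elimination turns an invertible matrix into the identity, since an
  invertible square matrix in reduced row echelon form has a pivot in every row. It only
  remains to see that the algorithm proceeds by the three elementary operations: clearing a
  column in a single step is a sequence of row additions (lemma \<open>row_ops_gauss_jordan_main\<close>).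
\<close>

lemma elem_row_op_left_mult_Unit:
  fixes A :: "'a :: field mat"
  assumes "elem_row_op A B" and "A \<in> carrier_mat n nc"
  shows "\<exists>P \<in> Units (ring_mat TYPE('a) n b). B = P * A"
  using assms
proof cases
  case (swap k l)
  then show ?thesis
    using assms(2) by (intro bexI[of _ "swaprows_mat n k l"]) (auto simp: swaprows_mat[OF assms(2)] intro: swaprows_mat_Unit)
next
  case (scale k c)
  then show ?thesis
    using assms(2) by (intro bexI[of _ "multrow_mat n k c"]) (auto simp: multrow_mat[OF assms(2)] intro: multrow_mat_Unit)
next
  case (add k l c)
  then show ?thesis
    using assms(2) by (intro bexI[of _ "addrow_mat n c k l"]) (auto simp: addrow_mat[OF assms(2)] intro: addrow_mat_Unit)
qed

lemma row_ops_left_mult_Unit: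
  fixes A :: "'a :: field mat"
  assumes "elem_row_op\<^sup>*\<^sup>* A B" and A: "A \<in> carrier_mat n nc"
  shows "\<exists>P \<in> Units (ring_mat TYPE('a) n b). B = P * A"
  using assms(1)
proof (induction rule: rtranclp_induct)
  case base
  show ?case
    using A by (intro bexI[of _ "1\<^sub>m n"]) (auto simp: Units_def ring_mat_def)
next
  case (step B C)
  interpret m: ring "ring_mat TYPE('a) n b" by (rule ring_mat)
  obtain P where P: "P \<in> Units (ring_mat TYPE('a) n b)" and B: "B = P * A"
    using step.IH by blast
  have Pc: "P \<in> carrier_mat n n"
    using m.Units_closed[OF P] by (simp add: ring_mat_simps)
  have "B \<in> carrier_mat n nc"
    using B Pc A by simp
  then obtain Q where Q: "Q \<in> Units (ring_mat TYPE('a) n b)" and C: "C = Q * B"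
    using elem_row_op_left_mult_Unit[OF step.hyps(2), where b = b] by blast
  have Qc: "Q \<in> carrier_mat n n"
    using m.Units_closed[OF Q] by (simp add: ring_mat_simps)
  have "Q * P \<in> Units (ring_mat TYPE('a) n b)"
    using m.Units_m_closed[OF Q P] by (simp add: ring_mat_simps)
  moreover have "C = (Q * P) * A"
    using B C assoc_mult_mat[OF Qc Pc A] by simp
  ultimately show ?case by blast
qed

lemma invertible_mat_iff_Units:
  fixes A :: "'a :: field mat"
  assumes "A \<in> carrier_mat n n"
  shows "invertible_mat A \<longleftrightarrow> A \<in> Units (ring_mat TYPE('a) n b)"
proof
  assume "invertible_mat A"
  then obtain B where 1: "A * B = 1\<^sub>m n" and 2: "B * A = 1\<^sub>m (dim_row B)"
    using assms by (auto simp: invertible_mat_def inverts_mat_def)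
  \<comment> \<open>The inverse is of unspecified size; the sizes of the two products determine it.\<close>
  have "dim_col B = n" "dim_row B = n"
    using arg_cong[OF 1, of dim_col] arg_cong[OF 2, of dim_col] assms by auto
  then have "B \<in> carrier_mat n n" by auto
  then show "A \<in> Units (ring_mat TYPE('a) n b)"
    using 1 2 assms by (auto simp: Units_def ring_mat_simps)
next
  assume "A \<in> Units (ring_mat TYPE('a) n b)"
  then show "invertible_mat A"
    using assms by (auto simp: Units_def ring_mat_simps invertible_mat_def inverts_mat_def)
qed

lemma row_ops_eliminate_entries_rec:
  fixes A :: "'a :: field mat"
  assumes "i < dim_row A" and "\<And>a k. (a, k) \<in> set xs \<Longrightarrow> k < dim_row A \<and> k \<noteq> i"
  shows "elem_row_op\<^sup>*\<^sup>* A (eliminate_entries_rec A i xs)"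
  using assms
proof (induction xs arbitrary: A)
  case Nil
  show ?case by simp
next
  case (Cons x xs)
  obtain a k where x: "x = (a, k)" by force
  have "elem_row_op A (addrow a k i A)"
    using Cons.prems x by (intro elem_row_op.add) auto
  moreover have "elem_row_op\<^sup>*\<^sup>* (addrow a k i A) (eliminate_entries_rec (addrow a k i A) i xs)"
    using Cons.prems by (intro Cons.IH) auto
  ultimately have "elem_row_op\<^sup>*\<^sup>* A (eliminate_entries_rec (addrow a k i A) i xs)"
    by (rule converse_rtranclp_into_rtranclp)
  then show ?case
    using x by simp
qed

text \<open>
  Subtracting multiples of row \<open>i\<close> from all other rows at once leaves row \<open>i\<close> unchanged, so it
  has the same effect as subtracting them one row after the other.
\<close>

lemma row_ops_eliminate_entries:
  fixes A :: "'a :: field mat"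
  assumes "i < dim_row A" and "j < dim_col A"
  shows "elem_row_op\<^sup>*\<^sup>* A (eliminate_entries (\<lambda>k. A $$ (k, j)) A i j)"
  unfolding eliminate_entries_convert[OF assms(2,1) refl]
  by (rule row_ops_eliminate_entries_rec) (use assms in auto)

text \<open>
  Every recursive call of the algorithm receives a first matrix that arises from \<open>A\<close> by row
  operations: a swap that brings a nonzero entry to the pivot position, a scaling that makes the
  pivot equal to one, or the clearing of the other entries of the pivot column.
\<close>

lemma row_ops_gauss_jordan_main:
  fixes A :: "'a :: field mat"
  shows "elem_row_op\<^sup>*\<^sup>* A (fst (gauss_jordan_main A B i j))"
proof (induction A B i j rule: gauss_jordan_main.induct)
  case (1 A B i j)
  note unf = gauss_jordan_main.simps[of A B i j] Let_def
  note IH = 1[OF refl refl]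
  show ?case
  proof (cases "i < dim_row A \<and> j < dim_col A")
    case False
    then show ?thesis by (auto simp: unf)
  next
    case valid: True
    note IH = IH[OF valid refl]
    consider (zero) "A $$ (i,j) = 0" | (one) "A $$ (i,j) = 1"
      | (other) "A $$ (i,j) \<noteq> 0" "A $$ (i,j) \<noteq> 1" by blast
    then show ?thesis
    proof cases
      case zero
      show ?thesis
      proof (cases "[i'. i' <- [Suc i ..< dim_row A], A $$ (i',j) \<noteq> 0]")
        case Nil
        have "gauss_jordan_main A B i j = gauss_jordan_main A B i (Suc j)"
          unfolding unf Nil using zero valid by simp
        then show ?thesis
          using IH(1)[OF zero Nil] by simp
      next
        case (Cons k ks)
        have "k \<in> set [i'. i' <- [Suc i ..< dim_row A], A $$ (i',j) \<noteq> 0]"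
          unfolding Cons by simp
        then have "elem_row_op A (swaprows i k A)"
          using valid by (intro elem_row_op.swap) auto
        then have "elem_row_op\<^sup>*\<^sup>* A (fst (gauss_jordan_main (swaprows i k A) (swaprows i k B) i j))"
          using IH(2)[OF zero Cons] by (rule converse_rtranclp_into_rtranclp)
        moreover have "gauss_jordan_main A B i j =
            gauss_jordan_main (swaprows i k A) (swaprows i k B) i j"
          unfolding unf Cons using zero valid by simp
        ultimately show ?thesis by simp
      qed
    next
      case one
      then have "A $$ (i,j) \<noteq> 0" by simp
      from rtranclp_trans[OF row_ops_eliminate_entries IH(3)[OF this one refl]]
      show ?thesis
        using one valid by (simp add: unf)
    next
      case other
      have "elem_row_op A (multrow i (inverse (A $$ (i,j))) A)"
        using other valid by (intro elem_row_op.scale) auto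
      from converse_rtranclp_into_rtranclp[of elem_row_op, OF this IH(4)[OF other refl]]
      show ?thesis
        using other valid by (simp add: unf)
    qed
  qed
qed

theorem theorem2:
  fixes A :: "real mat" and n :: nat
  assumes "1 \<le> n" and "A \<in> carrier_mat n n"
  shows "invertible_mat A \<longleftrightarrow> row_equivalent A (1\<^sub>m n)"
proof
  assume "invertible_mat A"
  then have "A \<in> Units (ring_mat TYPE(real) n ())"
    using invertible_mat_iff_Units[OF assms(2), where b = "()"] by blast
  then have "fst (gauss_jordan A (1\<^sub>m n)) = 1\<^sub>m n"
    using gauss_jordan_check_invertable[OF assms(2) one_carrier_mat, where b = "()"] by blast
  then have "elem_row_op\<^sup>*\<^sup>* A (1\<^sub>m n)"
    using row_ops_gauss_jordan_main[of A "1\<^sub>m n" 0 0] by (simp add: gauss_jordan_def)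
  then show "row_equivalent A (1\<^sub>m n)"
    by (simp add: row_equivalent_def)
next
  let ?R = "ring_mat TYPE(real) n ()"
  interpret m: ring ?R by (rule ring_mat)
  assume "row_equivalent A (1\<^sub>m n)"
  then consider (to_one) "elem_row_op\<^sup>*\<^sup>* A (1\<^sub>m n)" | (from_one) "elem_row_op\<^sup>*\<^sup>* (1\<^sub>m n) A"
    unfolding row_equivalent_def by blast
  then have "A \<in> Units ?R"
  proof cases
    case to_one
    then obtain P where P: "P \<in> Units ?R" and PA: "1\<^sub>m n = P * A"
      using row_ops_left_mult_Unit[OF _ assms(2), where b = "()"] by blast
    have Pc: "P \<in> carrier_mat n n" and Qc: "inv\<^bsub>?R\<^esub> P \<in> carrier_mat n n"
      using m.Units_closed[OF P] m.Units_inv_closed[OF P] by (simp_all add: ring_mat_simps)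
    have "A = (inv\<^bsub>?R\<^esub> P * P) * A"
      using m.Units_l_inv[OF P] assms(2) by (simp add: ring_mat_simps)
    also have "\<dots> = inv\<^bsub>?R\<^esub> P"
      using assoc_mult_mat[OF Qc Pc assms(2)] PA[symmetric] Qc by simp
    finally have "A = inv\<^bsub>?R\<^esub> P" .
    then show ?thesis
      using P m.Units_inv_Units by simp
  next
    case from_one
    then obtain P where P: "P \<in> Units ?R" and "A = P * 1\<^sub>m n"
      using row_ops_left_mult_Unit[OF _ one_carrier_mat, where b = "()"] by blast
    then show ?thesis
      using m.Units_closed[OF P] by (simp add: ring_mat_simps)
  qed
  then show "invertible_mat A"
    using invertible_mat_iff_Units[OF assms(2), where b = "()"] by blast
qed

end
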